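(* Let $D\subset\mathbb C^n$ be a bounded strongly convex domain with smooth boundary and let $\varphi:\mathbb D\to D$ be a complex geodesic. If $\rho:D\to\varphi(\mathbb D)$ is a holomorphic retraction whose fibers are intersections of $D$ with complex affine hyperplanes, then $\rho$ is the Lempert projection associated to $\varphi$.
   Context: $\mathbb D=\{\zeta\in\mathbb C:|\zeta|<1\}$. "Strongly convex with smooth boundary" means that $\partial D$ is $C^\infty$ and the real Hessian of a defining function is positive definite on the tangent spaces of $\partial D$. A complex geodesic is a holomorphic map $\varphi:\mathbb D\to D$ which is an isometry between the Poincaré distance of $\mathbb D$ and the Kobayashi distance of $D$; by Lempert it extends smoothly to $\overline{\mathbb D}$ with $\varphi(\partial\mathbb D)\subset\partial D$. A holomorphic retraction onto $\varphi(\mathbb D)$ is a holomorphic map $\rho:D\to\varphi(\mathbb D)\subset D$ with $\rho\circ\rho=\rho$ and $\rho(z)=z$ for all $z\in\varphi(\mathbb D)$. Lempert projection. For $a,b\in\mathbb C^n$ put $a\cdot b=\sum_ja_jb_j$. The dual map of $\varphi$ is the holomorphic map $\tilde\varphi:\mathbb D\to\mathbb C^n$, smooth up to $\partial\mathbb D$, such that $\tilde\varphi(e^{i\theta})=e^{i\theta}\mu(e^{i\theta})\,\partial r_{\varphi(e^{i\theta})}$ with $r$ a defining function of $D$ near $\varphi(\partial\mathbb D)$, $\partial r=(\partial r/\partial z_1,\dots,\partial r/\partial z_n)$, and $\mu>0$ normalized so that $\tilde\varphi(\zeta)\cdot\varphi'(\zeta)\equiv1$ on $\mathbb D$. For every $z\in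 D$ the equation $\tilde\varphi(\zeta)\cdot(z-\varphi(\zeta))=0$ has a unique solution $\zeta=\tilde\rho(z)\in\mathbb D$; the map $\tilde\rho:D\to\mathbb D$ is holomorphic and satisfies $\tilde\rho\circ\varphi=\mathrm{id}_{\mathbb D}$. The Lempert projection associated to $\varphi$ is $\varphi\circ\tilde\rho:D\to\varphi(\mathbb D)$. *)

theory Defs
  imports "HOL-Complex_Analysis.Complex_Analysis"
begin

text \<open>Smoothness on an open set, through iterated directional derivatives.\<close>

primrec Ck_on :: "nat \<Rightarrow> ('a::real_normed_vector \<Rightarrow> 'b::real_normed_vector) \<Rightarrow> 'a set \<Rightarrow> bool"
where
  "Ck_on 0 f S \<longleftrightarrow> continuous_on S f"
| "Ck_on (Suc k) f S \<longleftrightarrow>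
     (\<forall>x\<in>S. f differentiable (at x)) \<and> (\<forall>v. Ck_on k (\<lambda>x. frechet_derivative f (at x) v) S)"

definition smooth_on :: "('a::real_normed_vector \<Rightarrow> 'b::real_normed_vector) \<Rightarrow> 'a set \<Rightarrow> bool"
where
  "smooth_on f S \<longleftrightarrow> (\<forall>k. Ck_on k f S)"

definition bilinear_dot :: "complex ^ 'n \<Rightarrow> complex ^ 'n \<Rightarrow> complex"  (infixl "\<cdot>\<^sub>C" 70)
where
  "a \<cdot>\<^sub>C b = (\<Sum>j\<in>UNIV. a $ j * b $ j)"

text \<open>Several-variable holomorphy on an open set: the real Frechet derivative exists and is
  complex linear.\<close>

definition holomorphic_map_on ::
  "(complex ^ 'n \<Rightarrow> complex ^ 'm) \<Rightarrow> (complex ^ 'n) set \<Rightarrow> bool"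
where
  "holomorphic_map_on f S \<longleftrightarrow>
     (\<forall>z\<in>S. \<exists>L. (f has_derivative L) (at z) \<and> (\<forall>c v. L (c *s v) = c *s L v))"

definition holomorphic_disc :: "(complex \<Rightarrow> complex ^ 'n) \<Rightarrow> bool"
where
  "holomorphic_disc f \<longleftrightarrow> (\<forall>j. (\<lambda>\<zeta>. f \<zeta> $ j) holomorphic_on ball 0 1)"

definition disc_deriv :: "(complex \<Rightarrow> complex ^ 'n) \<Rightarrow> complex \<Rightarrow> complex ^ 'n"
where
  "disc_deriv f \<zeta> = (\<chi> j. deriv (\<lambda>\<xi>. f \<xi> $ j) \<zeta>)"

definition poincare_dist :: "complex \<Rightarrow> complex \<Rightarrow> real"
where
  "poincare_dist \<zeta> \<eta> = artanh (cmod ((\<zeta> - \<eta>) / (1 - cnj \<eta> * \<zeta>)))"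

text \<open>The Kobayashi distance is the infimum of the lengths of chains of analytic discs
  \<open>f 0, \<dots>, f (m - 1)\<close> in \<open>D\<close> joining \<open>z = p 0\<close> to \<open>w = p m\<close>.\<close>

definition kobayashi_dist :: "(complex ^ 'n) set \<Rightarrow> complex ^ 'n \<Rightarrow> complex ^ 'n \<Rightarrow> real"
where
  "kobayashi_dist D z w =
     Inf {(\<Sum>j<m. poincare_dist (a j) (b j)) |(m::nat) a b p f.
            0 < m \<and> p 0 = z \<and> p m = w \<and>
            (\<forall>j<m. holomorphic_disc (f j) \<and> f j ` ball 0 1 \<subseteq> D \<and>
                   a j \<in> ball 0 1 \<and> b j \<in> ball 0 1 \<and>
                   f j (a j) = p j \<and> f j (b j) = p (Suc j))}"

definition complex_geodesic :: "(complex ^ 'n) set \<Rightarrow> (complex \<Rightarrow> complex ^ 'n) \<Rightarrow> bool"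
where
  "complex_geodesic D \<phi> \<longleftrightarrow>
     holomorphic_disc \<phi> \<and> \<phi> ` ball 0 1 \<subseteq> D \<and>
     (\<forall>\<zeta>\<in>ball 0 1. \<forall>\<eta>\<in>ball 0 1. kobayashi_dist D (\<phi> \<zeta>) (\<phi> \<eta>) = poincare_dist \<zeta> \<eta>)"

definition defining_function_on ::
  "(complex ^ 'n) set \<Rightarrow> (complex ^ 'n) set \<Rightarrow> (complex ^ 'n \<Rightarrow> real) \<Rightarrow> bool"
where
  "defining_function_on D U r \<longleftrightarrow>
     open U \<and> smooth_on r U \<and>
     D \<inter> U = {z \<in> U. r z < 0} \<and>
     frontier D \<inter> U = {z \<in> U. r z = 0} \<and>
     (\<forall>z \<in> frontier D \<inter> U. frechet_derivative r (at z) \<noteq> (\<lambda>v. 0))"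

text \<open>The tangent space of the boundary at \<open>z\<close> is the kernel of the derivative of \<open>r\<close> at \<open>z\<close>;
  the second derivative of \<open>r\<close> in direction \<open>v\<close> is the value at \<open>v\<close> of the quadratic form of
  the real Hessian.\<close>

definition strongly_convex_smooth :: "(complex ^ 'n) set \<Rightarrow> bool"
where
  "strongly_convex_smooth D \<longleftrightarrow>
     (\<exists>U r. defining_function_on D U r \<and> frontier D \<subseteq> U \<and>
        (\<forall>z\<in>frontier D. \<forall>v. v \<noteq> 0 \<and> frechet_derivative r (at z) v = 0 \<longrightarrow>
           frechet_derivative (\<lambda>x. frechet_derivative r (at x) v) (at z) v > 0))"

definition holomorphic_retraction_onto ::
  "(complex ^ 'n) set \<Rightarrow> (complex ^ 'n) set \<Rightarrow> (complex ^ 'n \<Rightarrow> complex ^ 'n) \<Rightarrow> bool"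
where
  "holomorphic_retraction_onto D S \<rho> \<longleftrightarrow>
     holomorphic_map_on \<rho> D \<and> \<rho> ` D \<subseteq> S \<and> S \<subseteq> D \<and>
     (\<forall>z\<in>D. \<rho> (\<rho> z) = \<rho> z) \<and> (\<forall>z\<in>S. \<rho> z = z)"

definition complex_affine_hyperplane :: "(complex ^ 'n) set \<Rightarrow> bool"
where
  "complex_affine_hyperplane H \<longleftrightarrow> (\<exists>a c. a \<noteq> 0 \<and> H = {z. a \<cdot>\<^sub>C z = c})"

text \<open>The vector of Wirtinger derivatives
  \<open>\<partial>r/\<partial>z\<^sub>j = (\<partial>r/\<partial>x\<^sub>j - \<i> \<partial>r/\<partial>y\<^sub>j) / 2\<close>.\<close>

definition dz_gradient :: "(complex ^ 'n \<Rightarrow> real) \<Rightarrow> complex ^ 'n \<Rightarrow> complex ^ 'n"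
where
  "dz_gradient r z =
     (\<chi> j. (of_real (frechet_derivative r (at z) (axis j 1))
            - \<i> * of_real (frechet_derivative r (at z) (axis j \<i>))) / 2)"

text \<open>\<open>F\<close> extends \<open>f\<close> from the open disc smoothly up to the unit circle; the values of \<open>F\<close> on the
  closed disc are determined by \<open>f\<close>.\<close>

definition smooth_extension :: "(complex \<Rightarrow> complex ^ 'n) \<Rightarrow> (complex \<Rightarrow> complex ^ 'n) \<Rightarrow> bool"
where
  "smooth_extension f F \<longleftrightarrow>
     (\<forall>\<zeta>\<in>ball 0 1. F \<zeta> = f \<zeta>) \<and> (\<exists>W. open W \<and> cball 0 1 \<subseteq> W \<and> smooth_on F W)"

text \<open>The functions \<open>\<phi>\<close> and \<open>\<phi>t\<close> matter on the open disc only, so their boundary values are those of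
  the smooth extensions \<open>\<Phi>\<close> and \<open>\<Phi>t\<close>.\<close>

definition dual_map ::
  "(complex ^ 'n) set \<Rightarrow> (complex \<Rightarrow> complex ^ 'n) \<Rightarrow> (complex \<Rightarrow> complex ^ 'n) \<Rightarrow> bool"
where
  "dual_map D \<phi> \<phi>t \<longleftrightarrow>
     holomorphic_disc \<phi>t \<and>
     (\<exists>\<Phi> \<Phi>t U r \<mu>.
        smooth_extension \<phi> \<Phi> \<and> smooth_extension \<phi>t \<Phi>t \<and>
        defining_function_on D U r \<and> \<Phi> ` sphere 0 1 \<subseteq> U \<and>
        (\<forall>\<zeta>\<in>sphere 0 1. (\<mu> \<zeta> :: real) > 0 \<and>
           \<Phi>t \<zeta> = (\<zeta> * of_real (\<mu> \<zeta>)) *s dz_gradient r (\<Phi> \<zeta>))) \<and>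
     (\<forall>\<zeta>\<in>ball 0 1. \<phi>t \<zeta> \<cdot>\<^sub>C disc_deriv \<phi> \<zeta> = 1)"

definition lempert_left_inverse ::
  "(complex \<Rightarrow> complex ^ 'n) \<Rightarrow> (complex \<Rightarrow> complex ^ 'n) \<Rightarrow> complex ^ 'n \<Rightarrow> complex"
where
  "lempert_left_inverse \<phi> \<phi>t z = (THE \<zeta>. \<zeta> \<in> ball 0 1 \<and> \<phi>t \<zeta> \<cdot>\<^sub>C (z - \<phi> \<zeta>) = 0)"

definition lempert_projection ::
  "(complex \<Rightarrow> complex ^ 'n) \<Rightarrow> (complex \<Rightarrow> complex ^ 'n) \<Rightarrow> complex ^ 'n \<Rightarrow> complex ^ 'n"
where
  "lempert_projection \<phi> \<phi>t z = \<phi> (lempert_left_inverse \<phi> \<phi>t z)"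

end

theory Submission
  imports Defs
begin

text \<open>The fiber of \<open>\<rho>\<close> over \<open>\<phi> \<zeta>\<close> is \<open>D\<close> intersected with the hyperplane through \<open>\<phi> \<zeta>\<close> whose normal
  \<open>a \<zeta>\<close>, normalised by \<open>a \<zeta> \<cdot> \<phi>' \<zeta> = 1\<close>, has the components \<open>\<phi>t \<zeta> \<cdot> d\<rho> (e\<^sub>j)\<close>, the differential being
  taken at \<open>\<phi> \<zeta>\<close>; hence \<open>a\<close> is holomorphic. When \<open>\<zeta>\<close> tends to a point of the unit circle,
  a limit of these hyperplanes cannot enter \<open>D\<close>, since \<open>\<rho>\<close> is continuous on \<open>D\<close> with values in \<open>D\<close>.
  So the limit is the complex tangent space of the boundary, and by the normalisation \<open>a\<close> and \<open>\<phi>t\<close>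
  have the same boundary values. The maximum principle gives \<open>a = \<phi>t\<close>: the fibers of \<open>\<rho>\<close> are those
  of the Lempert projection.\<close>

section \<open>The bilinear product on complex vectors\<close>

lemma bilinear_dot_add_right: "a \<cdot>\<^sub>C (x + y) = a \<cdot>\<^sub>C x + a \<cdot>\<^sub>C y"
  by (simp add: bilinear_dot_def algebra_simps sum.distrib)

lemma bilinear_dot_diff_right: "a \<cdot>\<^sub>C (x - y) = a \<cdot>\<^sub>C x - a \<cdot>\<^sub>C y"
  by (simp add: bilinear_dot_def algebra_simps sum_subtractf)

lemma bilinear_dot_scale_right: "a \<cdot>\<^sub>C (c *s x) = c * (a \<cdot>\<^sub>C x)"
  by (simp add: bilinear_dot_def sum_distrib_left algebra_simps)

lemma bilinear_dot_scale_left: "(c *s a) \<cdot>\<^sub>C x = c * (a \<cdot>\<^sub>C x)"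
  by (simp add: bilinear_dot_def sum_distrib_left algebra_simps)

lemma bilinear_dot_axis: "a \<cdot>\<^sub>C axis j c = a $ j * c"
  by (simp add: bilinear_dot_def axis_def if_distrib cong: if_cong)

text \<open>The conjugate vector is the standard choice of a vector off the kernel of
  \<open>a\<close>; for a unit vector the product is 1.\<close>

lemma bilinear_dot_cnj: "a \<cdot>\<^sub>C (\<chi> j. cnj (a $ j)) = of_real ((norm a)\<^sup>2)"
proof -
  have "(norm a)\<^sup>2 = (\<Sum>j\<in>UNIV. (cmod (a $ j))\<^sup>2)"
    by (simp add: norm_vec_def L2_set_def sum_nonneg)
  then show ?thesis
    by (simp only: bilinear_dot_def of_real_sum vec_lambda_beta complex_norm_square)
qed

lemma norm_vector_smult: "norm (c *s x) = cmod c * norm x" for x :: "complex ^ 'n"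
  by (simp add: norm_vec_def L2_set_def norm_mult power_mult_distrib
      flip: sum_distrib_left add: real_sqrt_mult)

lemma scaleR_eq_vector_smult: "t *\<^sub>R x = complex_of_real t *s x" for x :: "complex ^ 'n"
  by (simp add: vec_eq_iff) (simp add: scaleR_conv_of_real)

lemma tendsto_bilinear_dot [tendsto_intros]:
  "(f \<longlongrightarrow> a) F \<Longrightarrow> (g \<longlongrightarrow> b) F \<Longrightarrow> ((\<lambda>x. f x \<cdot>\<^sub>C g x) \<longlongrightarrow> a \<cdot>\<^sub>C b) F"
  unfolding bilinear_dot_def by (intro tendsto_intros)

lemma tendsto_vector_smult [tendsto_intros]:
  fixes g :: "'a \<Rightarrow> complex ^ 'n"
  shows "(f \<longlongrightarrow> a) F \<Longrightarrow> (g \<longlongrightarrow> b) F \<Longrightarrow> ((\<lambda>x. f x *s g x) \<longlongrightarrow> a *s b) F"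
  unfolding vector_scalar_mult_def by (intro tendsto_intros)

section \<open>Vector-valued derivatives and holomorphic dependence on a parameter\<close>

lemma has_derivative_vec_componentwise:
  fixes f :: "'a::real_normed_vector \<Rightarrow> 'b::euclidean_space ^ 'n"
  assumes "\<And>j. ((\<lambda>x. f x $ j) has_derivative (\<lambda>h. f' h $ j)) (at x within S)"
  shows "(f has_derivative f') (at x within S)"
proof (subst has_derivative_componentwise_within, rule ballI)
  fix b :: "'b ^ 'n" assume "b \<in> Basis"
  then obtain j c where "b = axis j c" by (auto simp: Basis_vec_def)
  then show "((\<lambda>x. f x \<bullet> b) has_derivative (\<lambda>h. f' h \<bullet> b)) (at x within S)"
    using has_derivative_inner_left[OF assms[of j], of c] by (simp add: inner_axis)
qed

lemma holomorphic_disc_has_derivative: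
  assumes "holomorphic_disc f" "\<zeta> \<in> ball 0 1"
  shows "(f has_derivative (\<lambda>h. h *s disc_deriv f \<zeta>)) (at \<zeta>)"
proof (rule has_derivative_vec_componentwise)
  fix j
  have "((\<lambda>\<xi>. f \<xi> $ j) has_field_derivative deriv (\<lambda>\<xi>. f \<xi> $ j) \<zeta>) (at \<zeta>)"
    using assms by (auto simp: holomorphic_disc_def intro!: holomorphic_derivI[OF _ open_ball])
  then show "((\<lambda>\<xi>. f \<xi> $ j) has_derivative (\<lambda>h. (h *s disc_deriv f \<zeta>) $ j)) (at \<zeta>)"
    by (simp add: has_field_derivative_def disc_deriv_def mult.commute[of _ "deriv _ _"])
qed

text \<open>The difference quotients in the second variable converge uniformly in the first one,
  because Cauchy's inequality bounds the second derivative.\<close>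

lemma holomorphic_on_partial_deriv:
  fixes f :: "complex \<Rightarrow> complex \<Rightarrow> complex"
  assumes S: "open S" and R: "0 < R"
    and h1: "\<And>t. t \<in> ball 0 R \<Longrightarrow> (\<lambda>x. f x t) holomorphic_on S"
    and h2: "\<And>x. x \<in> S \<Longrightarrow> f x holomorphic_on ball 0 R"
    and M: "\<And>x t. x \<in> S \<Longrightarrow> t \<in> ball 0 R \<Longrightarrow> cmod (f x t) \<le> M"
  shows "(\<lambda>x. deriv (f x) 0) holomorphic_on S"
proof -
  \<comment> \<open>All \<open>s n\<close> lie in \<open>cball 0 (R/4)\<close>, and discs of radius
    \<open>R/4\<close> about points of that disc stay in \<open>ball 0 R\<close>, as Cauchy's
    inequality requires.\<close>
  define s where "s n = R / (4 * real (Suc n))" for n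
  define q where "q n x = (f x (of_real (s n)) - f x 0) / of_real (s n)"
    for n :: nat and x
  \<comment> \<open>Cauchy's bound for the second derivative; the first-order Taylor remainder turns
    it into the error bound \<open>B * s n\<close> for the difference quotient.\<close>
  define B where "B = 2 * M / (R/4)^2"
  have s0: "0 < s n" for n
    using R by (simp add: s_def)
  have sR: "s n \<le> R / 4" for n
    unfolding s_def using R by (intro divide_left_mono) auto
  have est: "cmod (q n x - deriv (f x) 0) \<le> B * s n" if x: "x \<in> S" for n x
  proof -
    let ?t = "of_real (s n) :: complex"
    have t0: "?t \<noteq> 0" using s0[of n] by simp
    have ct: "cmod ?t = s n" using s0[of n] by simp
    have "cmod ((deriv ^^ 0) (f x) ?t - (\<Sum>i\<le>1. (deriv ^^ i) (f x) 0 * (?t - 0) ^ i / fact i))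
        \<le> B * cmod (?t - 0) ^ Suc 1 / fact 1"
    proof (rule complex_Taylor[where S = "cball 0 (R/4)"])
      show "((deriv ^^ i) (f x) has_field_derivative (deriv ^^ Suc i) (f x) y)
              (at y within cball 0 (R/4))" if "y \<in> cball 0 (R/4)" for i y
      proof -
        have "y \<in> ball 0 R" using that R by simp
        from holomorphic_derivI[OF holomorphic_higher_deriv[OF h2[OF x] open_ball] open_ball this]
        show ?thesis by (simp add: has_field_derivative_at_within)
      qed
      show "cmod ((deriv ^^ Suc 1) (f x) y) \<le> B" if y: "y \<in> cball 0 (R/4)" for y
      proof -
        have sub: "cball y (R/4) \<subseteq> ball 0 R"
        proof
          fix w assume "w \<in> cball y (R/4)"
          then have "norm w \<le> R/4 + R/4"
            using y norm_triangle_sub[of w y] by (simp add: dist_norm norm_minus_commute)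
          then show "w \<in> ball 0 R" using R by simp
        qed
        have "cmod ((deriv ^^ 2) (f x) y) \<le> fact 2 * M / (R/4)^2"
        proof (rule Cauchy_inequality)
          show "f x holomorphic_on ball y (R/4)"
            using h2[OF x] sub by (meson ball_subset_cball holomorphic_on_subset subset_trans)
          show "continuous_on (cball y (R/4)) (f x)"
            using h2[OF x] sub holomorphic_on_imp_continuous_on continuous_on_subset by blast
          show "cmod (f x w) \<le> M" if "cmod (y - w) = R/4" for w
            using M[OF x, of w] sub that by (auto simp: dist_norm)
        qed (use R in auto)
        then show ?thesis by (simp add: B_def numeral_2_eq_2)
      qed
      show "?t \<in> cball 0 (R/4)" using sR[of n] s0[of n] by simp
    qed (use R in auto)
    then have "cmod (f x ?t - f x 0 - deriv (f x) 0 * ?t) \<le> B * (cmod ?t)\<^sup>2"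
      by (simp add: power2_eq_square algebra_simps)
    moreover have "f x ?t - f x 0 - deriv (f x) 0 * ?t = (q n x - deriv (f x) 0) * ?t"
      using t0 unfolding q_def by (simp add: field_simps)
    ultimately have "cmod (q n x - deriv (f x) 0) * cmod ?t \<le> (B * cmod ?t) * cmod ?t"
      by (simp only: norm_mult power2_eq_square mult.assoc)
    then have "cmod (q n x - deriv (f x) 0) \<le> B * cmod ?t"
      using t0 by (simp only: mult_le_cancel_right) simp
    then show ?thesis by (simp only: ct)
  qed
  show ?thesis
  proof (rule holomorphic_uniform_sequence[OF S])
    show "q n holomorphic_on S" for n
      unfolding q_def using R s0[of n] sR[of n] by (intro holomorphic_intros h1) auto
    fix x assume "x \<in> S"
    then obtain d where d: "0 < d" "cball x d \<subseteq> S"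
      using S open_contains_cball by blast
    have "uniform_limit (cball x d) q (\<lambda>x. deriv (f x) 0) sequentially"
    proof (rule uniform_limitI)
      fix e :: real assume "0 < e"
      have "(\<lambda>n. B * s n) \<longlonglongrightarrow> B * 0"
        using tendsto_mult[OF tendsto_const[of "R / 4"] LIMSEQ_inverse_real_of_nat]
        by (intro tendsto_mult tendsto_const) (simp add: s_def divide_simps)
      then have "\<forall>\<^sub>F n in sequentially. B * s n < e"
        using \<open>0 < e\<close> by (intro order_tendstoD) auto
      then show "\<forall>\<^sub>F n in sequentially. \<forall>y\<in>cball x d. dist (q n y) (deriv (f y) 0) < e"
      proof eventually_elim
        case (elim n)
        then show ?case
          using est[of _ n] d(2) by (metis dist_norm le_less_trans subsetD)
      qed
    qed
    with d show "\<exists>d>0. cball x d \<subseteq> S \<and> uniform_limit (cball x d) q (\<lambda>x. deriv (f x) 0) sequentially"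
      by blast
  qed
qed

section \<open>Poincare and Kobayashi distances, and geodesics near the circle\<close>

text \<open>Here \<open>artanh x\<close> is half the logarithm of \<open>(1 + x) / (1 - x)\<close>,
  which increases with \<open>x\<close>. Comparing distances thus reduces to comparing
  moduli.\<close>

lemma artanh_real_le_iff:
  fixes x y :: real
  assumes "0 \<le> x" "x < 1" "0 \<le> y" "y < 1"
  shows "artanh x \<le> artanh y \<longleftrightarrow> x \<le> y"
proof -
  have "artanh x \<le> artanh y \<longleftrightarrow> (1 + x) / (1 - x) \<le> (1 + y) / (1 - y)"
    using assms by (simp add: artanh_def)
  also have "\<dots> \<longleftrightarrow> x \<le> y"
    using assms by (simp add: divide_simps algebra_simps)
  finally show ?thesis .
qed

text \<open>The quotient is the value at \<zeta> of the Moebius automorphism of the disc that sends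
  \<eta> to 0.\<close>

lemma cmod_poincare_quotient_less_1:
  assumes "\<zeta> \<in> ball 0 1" "\<eta> \<in> ball 0 1"
  shows "cmod ((\<zeta> - \<eta>) / (1 - cnj \<eta> * \<zeta>)) < 1"
  using Moebius_function_norm_lt_1[of \<eta> \<zeta> 0] assms
  by (simp add: Moebius_function_def)

lemma poincare_dist_nonneg:
  assumes "\<zeta> \<in> ball 0 1" "\<eta> \<in> ball 0 1"
  shows "0 \<le> poincare_dist \<zeta> \<eta>"
  using artanh_real_le_iff[of 0, OF _ _ _ cmod_poincare_quotient_less_1[OF assms]]
  by (simp add: poincare_dist_def)

text \<open>A single disc is a chain of length one, and the infimum runs over a set bounded below by
  0.\<close>

lemma kobayashi_dist_le_disc:
  assumes "holomorphic_disc f" "f ` ball 0 1 \<subseteq> D" "\<alpha> \<in> ball 0 1" "\<beta> \<in> ball 0 1"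
  shows "kobayashi_dist D (f \<alpha>) (f \<beta>) \<le> poincare_dist \<alpha> \<beta>"
  unfolding kobayashi_dist_def
proof (rule cInf_lower)
  let ?p = "\<lambda>j::nat. if j = 0 then f \<alpha> else f \<beta>"
  show "poincare_dist \<alpha> \<beta> \<in> {(\<Sum>j<m. poincare_dist (a j) (b j)) |(m::nat) a b p g.
            0 < m \<and> p 0 = f \<alpha> \<and> p m = f \<beta> \<and>
            (\<forall>j<m. holomorphic_disc (g j) \<and> g j ` ball 0 1 \<subseteq> D \<and>
                   a j \<in> ball 0 1 \<and> b j \<in> ball 0 1 \<and>
                   g j (a j) = p j \<and> g j (b j) = p (Suc j))}"
    using assms
    by (intro CollectI exI[of _ 1] exI[of _ "\<lambda>_. \<alpha>"] exI[of _ "\<lambda>_. \<beta>"] exI[of _ ?p] exI[of _ "\<lambda>_. f"])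
      auto
next
  show "bdd_below {(\<Sum>j<m. poincare_dist (a j) (b j)) |(m::nat) a b p g.
            0 < m \<and> p 0 = f \<alpha> \<and> p m = f \<beta> \<and>
            (\<forall>j<m. holomorphic_disc (g j) \<and> g j ` ball 0 1 \<subseteq> D \<and>
                   a j \<in> ball 0 1 \<and> b j \<in> ball 0 1 \<and>
                   g j (a j) = p j \<and> g j (b j) = p (Suc j))}"
    by (rule bdd_belowI[of _ 0]) (auto intro!: sum_nonneg poincare_dist_nonneg)
qed

text \<open>The affine disc of radius \<open>R\<close> centred at \<open>p\<close> and passing
  through \<open>q\<close> stays in the ball; it reaches \<open>q\<close> at the parameter
  \<open>dist q p / R\<close>.\<close>

lemma kobayashi_dist_le_ball:
  fixes p q :: "complex ^ 'n"
  assumes "ball p R \<subseteq> D" "q \<in> ball p R" 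
  shows "kobayashi_dist D q p \<le> artanh (dist q p / R)"
proof (cases "q = p")
  case True
  \<comment> \<open>For \<open>q = p\<close> there is no direction to normalise, so a constant disc
    is used.\<close>
  define f :: "complex \<Rightarrow> complex ^ 'n" where "f = (\<lambda>_. p)"
  have "R > 0" using assms(2) by (smt (verit) mem_ball zero_le_dist)
  then have "kobayashi_dist D (f 0) (f 0) \<le> poincare_dist 0 0"
    using assms by (intro kobayashi_dist_le_disc) (auto simp: f_def holomorphic_disc_def)
  then show ?thesis using True by (simp add: f_def poincare_dist_def)
next
  case False
  define u where "u = of_real (R / dist q p) *s (q - p)"
  define f where "f = (\<lambda>t. p + t *s u)"
  have R: "R > 0" using assms(2) by (smt (verit) mem_ball zero_le_dist)
  have nu: "norm u = R"
    using R False unfolding u_def norm_vector_smult by (simp add: norm_divide dist_norm)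
  have s: "0 \<le> dist q p / R" "dist q p / R < 1"
    using assms(2) R by (auto simp: dist_commute)
  have "kobayashi_dist D (f (of_real (dist q p / R))) (f 0) \<le> poincare_dist (of_real (dist q p / R)) 0"
  proof (rule kobayashi_dist_le_disc)
    show "holomorphic_disc f"
      by (auto simp: holomorphic_disc_def f_def intro!: holomorphic_intros)
    show "f ` ball 0 1 \<subseteq> D"
      using assms(1) R by (auto simp: f_def dist_norm norm_vector_smult nu subset_iff)
    show "of_real (dist q p / R) \<in> ball (0::complex) 1"
      using s by (simp only: mem_ball_0 norm_of_real abs_of_nonneg)
  qed auto
  moreover have "f (of_real (dist q p / R)) = q"
    using False R by (simp add: f_def u_def vector_smult_assoc)
  moreover have "poincare_dist (of_real (dist q p / R)) 0 = artanh (dist q p / R)"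
    using s R unfolding poincare_dist_def by (simp add: norm_divide)
  ultimately show ?thesis by (simp add: f_def)
qed

text \<open>Equal images force Poincare distance 0, hence a vanishing Moebius quotient.\<close>

lemma complex_geodesic_inj_on:
  assumes "complex_geodesic D \<phi>"
  shows "inj_on \<phi> (ball 0 1)"
proof (rule inj_onI)
  fix \<zeta> \<eta> assume m: "\<zeta> \<in> ball 0 1" "\<eta> \<in> ball 0 1" and eq: "\<phi> \<zeta> = \<phi> \<eta>"
  have "poincare_dist \<zeta> \<eta> = poincare_dist \<zeta> \<zeta>"
    using assms m eq unfolding complex_geodesic_def by metis
  then have "cmod ((\<zeta> - \<eta>) / (1 - cnj \<eta> * \<zeta>)) \<le> 0"
    using artanh_real_le_iff[OF norm_ge_zero cmod_poincare_quotient_less_1[OF m], of 0]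
    by (simp add: poincare_dist_def)
  \<comment> \<open>Division by zero yields 0, so a vanishing quotient gives equal points only once
    the denominator is known to be nonzero.\<close>
  moreover have "1 - cnj \<eta> * \<zeta> \<noteq> 0"
  proof
    assume "1 - cnj \<eta> * \<zeta> = 0"
    then have "cmod (cnj \<eta> * \<zeta>) = 1" by (metis eq_iff_diff_eq_0 norm_one)
    moreover have "cmod \<eta> * cmod \<zeta> < 1 * 1"
      using m by (intro mult_strict_mono') auto
    ultimately show False by (simp add: norm_mult)
  qed
  ultimately show "\<zeta> = \<eta>" by simp
qed

text \<open>The Kobayashi distance is bounded near an interior point, while the Poincare distance to a
  boundary point is infinite.\<close>

lemma complex_geodesic_limit_not_in_image:
  assumes D: "open D" and geo: "complex_geodesic D \<phi>"
    and \<omega>: "\<omega> \<in> sphere 0 1" and \<zeta>: "\<And>k. \<zeta> k \<in> ball 0 1" "\<zeta> \<longlonglongrightarrow> \<omega>"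
    and \<eta>: "\<eta> \<in> ball 0 1" and lim: "(\<lambda>k. \<phi> (\<zeta> k)) \<longlonglongrightarrow> \<phi> \<eta>"
  shows False
proof -
  have "\<phi> \<eta> \<in> D" using geo \<eta> by (auto simp: complex_geodesic_def)
  then obtain R where R: "0 < R" "ball (\<phi> \<eta>) R \<subseteq> D"
    using D open_contains_ball by blast
  \<comment> \<open>On the circle numerator and denominator of the Moebius quotient have the same
    modulus, so the quotient tends to modulus 1, that is, to infinite Poincare distance.\<close>
  have ne: "cmod (1 - cnj \<eta> * \<omega>) = cmod (\<omega> - \<eta>)"
  proof -
    have "1 - cnj \<eta> * \<omega> = \<omega> * cnj (\<omega> - \<eta>)"
      using \<omega> complex_norm_square[of \<omega>] by (simp add: algebra_simps)
    then show ?thesis using \<omega> by (simp only: norm_mult complex_mod_cnj) simp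
  qed
  have neq: "\<omega> \<noteq> \<eta>" using \<omega> \<eta> by auto
  have "(\<lambda>k. cmod ((\<zeta> k - \<eta>) / (1 - cnj \<eta> * \<zeta> k))) \<longlonglongrightarrow> cmod ((\<omega> - \<eta>) / (1 - cnj \<eta> * \<omega>))"
    using ne neq by (intro tendsto_intros \<zeta>) auto
  then have lim1: "(\<lambda>k. cmod ((\<zeta> k - \<eta>) / (1 - cnj \<eta> * \<zeta> k))) \<longlonglongrightarrow> 1"
    using neq by (simp add: norm_divide ne)
  have lim0: "(\<lambda>k. dist (\<phi> (\<zeta> k)) (\<phi> \<eta>) / R) \<longlonglongrightarrow> 0"
    using tendsto_divide[OF lim[THEN tendsto_dist_iff[THEN iffD1]] tendsto_const[of R]] R by simp
  have "\<forall>\<^sub>F k in sequentially. dist (\<phi> (\<zeta> k)) (\<phi> \<eta>) < R"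
    using lim R tendstoD by blast
  then have "\<forall>\<^sub>F k in sequentially.
      cmod ((\<zeta> k - \<eta>) / (1 - cnj \<eta> * \<zeta> k)) \<le> dist (\<phi> (\<zeta> k)) (\<phi> \<eta>) / R"
  proof eventually_elim
    case (elim k)
    have "poincare_dist (\<zeta> k) \<eta> \<le> artanh (dist (\<phi> (\<zeta> k)) (\<phi> \<eta>) / R)"
      using kobayashi_dist_le_ball[OF R(2), of "\<phi> (\<zeta> k)"] elim geo \<zeta>(1)[of k] \<eta>
      by (simp add: complex_geodesic_def dist_commute)
    then show ?case
      using artanh_real_le_iff[OF norm_ge_zero cmod_poincare_quotient_less_1[OF \<zeta>(1)[of k] \<eta>],
          of "dist (\<phi> (\<zeta> k)) (\<phi> \<eta>) / R"] elim R
      by (simp add: poincare_dist_def)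
  qed
  \<comment> \<open>With \<open>artanh\<close> removed from both sides, the limit of the inequality
    reads \<open>1 \<le> 0\<close>.\<close>
  from tendsto_le[OF _ lim0 lim1 this] show False by simp
qed

section \<open>Boundary values on the disc and the Wirtinger gradient\<close>

text \<open>Smoothness of \<open>F\<close> near the closed disc makes \<open>F\<close> and its
  derivative in direction 1 continuous up to the circle. Inside the disc this directional derivative
  is the complex one, so \<open>disc_deriv f\<close> has boundary values even though
  \<open>F\<close> need not be holomorphic outside.\<close>

lemma holomorphic_disc_smooth_extension:
  assumes hol: "holomorphic_disc f" and ext: "smooth_extension f F"
  shows "continuous_on (cball 0 1) F"
    and "continuous_on (cball 0 1) (\<lambda>x. frechet_derivative F (at x) 1)"
    and "\<And>\<zeta>. \<zeta> \<in> ball 0 1 \<Longrightarrow> frechet_derivative F (at \<zeta>) 1 = disc_deriv f \<zeta>"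
proof -
  obtain W where W: "open W" "cball 0 1 \<subseteq> W" "smooth_on F W"
    using ext by (auto simp: smooth_extension_def)
  have "Ck_on 0 F W" "Ck_on (Suc 0) F W"
    using W(3) unfolding smooth_on_def by blast+
  then have "continuous_on W F" "continuous_on W (\<lambda>x. frechet_derivative F (at x) 1)"
    by auto
  then show "continuous_on (cball 0 1) F"
    and "continuous_on (cball 0 1) (\<lambda>x. frechet_derivative F (at x) 1)"
    using W(2) continuous_on_subset by blast+
  fix \<zeta> :: complex assume \<zeta>: "\<zeta> \<in> ball 0 1"
  have "(F has_derivative (\<lambda>h. h *s disc_deriv f \<zeta>)) (at \<zeta>)"
    by (rule has_derivative_transform_within_open[OF holomorphic_disc_has_derivative[OF hol \<zeta>] open_ball \<zeta>])
      (use ext in \<open>auto simp: smooth_extension_def\<close>)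
  from frechet_derivative_at[OF this, symmetric]
  show "frechet_derivative F (at \<zeta>) 1 = disc_deriv f \<zeta>" by simp
qed

text \<open>Expanding \<open>v\<close> in real coordinates exhibits the real differential as the
  real part of a complex linear form. If the differential vanishes at \<open>v\<close> and at
  \<open>\<i> *s v\<close>, the form therefore vanishes at \<open>v\<close>.\<close>

lemma frechet_derivative_eq_dz_gradient:
  assumes "r differentiable (at z)"
  shows "frechet_derivative r (at z) v = 2 * Re (dz_gradient r z \<cdot>\<^sub>C v)"
proof -
  let ?f = "frechet_derivative r (at z)"
  have lin: "linear ?f"
    by (rule linear_frechet_derivative[OF assms])
  have v: "v = (\<Sum>j\<in>UNIV. Re (v $ j) *\<^sub>R axis j 1 + Im (v $ j) *\<^sub>R axis j \<i>)"
    by (simp add: vec_eq_iff axis_def if_distrib complex_eq_iff cong: if_cong)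
  have "?f v = (\<Sum>j\<in>UNIV. Re (v $ j) * ?f (axis j 1) + Im (v $ j) * ?f (axis j \<i>))"
    by (subst v) (simp add: linear_sum[OF lin] linear_add[OF lin] linear_scale[OF lin])
  also have "\<dots> = (\<Sum>j\<in>UNIV. 2 * Re (dz_gradient r z $ j * v $ j))"
    by (intro sum.cong refl) (simp add: dz_gradient_def field_simps)
  finally show ?thesis
    by (simp add: bilinear_dot_def sum_distrib_left)
qed

section \<open>Complex hyperplanes: limits and normals of the fibers\<close>

text \<open>The conjugate of \<open>b\<close> spans a complement of the kernel of \<open>b\<close>.
  Subtracting a multiple of it moves each basis vector into the kernel, so \<open>g\<close> is
  determined by its value on that complement.\<close>

lemma bilinear_dot_proportional:
  assumes b: "norm b = 1" and ker: "\<And>v. b \<cdot>\<^sub>C v = 0 \<Longrightarrow> g \<cdot>\<^sub>C v = 0"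
  shows "\<exists>c. g = c *s b"
proof
  let ?n = "\<chi> j. cnj (b $ j)"
  have n: "b \<cdot>\<^sub>C ?n = 1" by (simp add: bilinear_dot_cnj b)
  show "g = (g \<cdot>\<^sub>C ?n) *s b"
    unfolding vec_eq_iff
  proof
    fix j
    have "b \<cdot>\<^sub>C (axis j 1 - (b $ j) *s ?n) = 0"
      by (simp add: bilinear_dot_diff_right bilinear_dot_scale_right bilinear_dot_axis n)
    then have "g \<cdot>\<^sub>C (axis j 1 - (b $ j) *s ?n) = 0" by (rule ker)
    then show "g $ j = ((g \<cdot>\<^sub>C ?n) *s b) $ j"
      by (simp add: bilinear_dot_diff_right bilinear_dot_scale_right bilinear_dot_axis mult.commute)
  qed
qed

text \<open>If the limit hyperplane entered \<open>D\<close>, then points of \<open>D\<close> converging to a point of \<open>D\<close> would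
  be mapped by \<open>\<rho>\<close> to points converging to the boundary.\<close>

lemma limit_of_fiber_normals:
  fixes D :: "(complex ^ 'n) set"
  assumes D: "open D" and \<rho>: "continuous_on D \<rho>" "\<rho> ` D \<subseteq> D"
    and r: "defining_function_on D U r" and p: "p \<in> U" "p \<in> frontier D"
    and P: "P \<longlonglongrightarrow> p" and A: "A \<longlonglongrightarrow> b" and b: "norm b = 1"
    and fib: "\<And>k z. z \<in> D \<Longrightarrow> A k \<cdot>\<^sub>C (z - P k) = 0 \<Longrightarrow> \<rho> z = P k"
    and v: "b \<cdot>\<^sub>C v = 0"
  shows "dz_gradient r p \<cdot>\<^sub>C v = 0"
proof -
  have U: "open U" and rp: "r p = 0" and DU: "D \<inter> U = {z \<in> U. r z < 0}"
    using r p by (auto simp: defining_function_on_def)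
  have "Ck_on (Suc 0) r U"
    using r unfolding defining_function_on_def smooth_on_def by blast
  then have diff: "r differentiable (at p)" using p by simp
  let ?f = "frechet_derivative r (at p)"
  have pD: "p \<notin> D" using p D by (simp add: frontier_def interior_open)
  \<comment> \<open>A direction of the limit hyperplane along which \<open>r\<close> decreases would
    lead from \<open>p\<close> into \<open>D\<close>.\<close>
  have no_neg: "\<not> ?f v < 0" if v: "b \<cdot>\<^sub>C v = 0" for v
  proof
    assume neg: "?f v < 0"
    let ?g = "\<lambda>t::real. p + t *\<^sub>R v"
    have "(?g has_derivative (\<lambda>t. t *\<^sub>R v)) (at 0)"
      by (auto intro!: derivative_eq_intros)
    moreover have "(r has_derivative ?f) (at (?g 0))"
      using diff frechet_derivative_works by auto
    ultimately have "((\<lambda>t. r (?g t)) has_derivative (\<lambda>t. ?f (t *\<^sub>R v))) (at 0)"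
      by (rule has_derivative_compose)
    then have "((\<lambda>t. r (?g t)) has_real_derivative ?f v) (at 0)"
      by (simp add: has_field_derivative_def linear_scale[OF linear_frechet_derivative[OF diff]]
          mult.commute[of _ "?f v"])
    from has_real_derivative_neg_dec_right[OF this neg]
    obtain d where d: "0 < d" "\<And>h. 0 < h \<Longrightarrow> h < d \<Longrightarrow> r (?g h) < 0"
      using rp by auto
    have "\<forall>\<^sub>F t in at_right 0. ?g t \<in> U"
    proof (rule topological_tendstoD[OF _ U])
      have "(?g \<longlongrightarrow> p + 0 *\<^sub>R v) (at_right 0)" by (intro tendsto_intros)
      then show "(?g \<longlongrightarrow> p) (at_right 0)" by simp
    qed (use p in auto)
    moreover have "\<forall>\<^sub>F t in at_right 0. t < d" "\<forall>\<^sub>F t::real in at_right 0. 0 < t"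
      using d(1) by (auto simp: eventually_at_right_less eventually_at_right_field)
    ultimately have "\<forall>\<^sub>F t in at_right 0. ?g t \<in> D"
      by eventually_elim (use d(2) DU in blast)
    then obtain t where t: "?g t \<in> D"
      using eventually_happens trivial_limit_at_right_real by blast
    let ?w = "?g t" and ?n = "\<chi> j. cnj (b $ j)"
    have n: "b \<cdot>\<^sub>C ?n = 1" by (simp add: bilinear_dot_cnj b)
    have bw: "b \<cdot>\<^sub>C (?w - p) = 0"
      by (simp add: scaleR_eq_vector_smult bilinear_dot_scale_right v)
    \<comment> \<open>A correction along the conjugate of \<open>b\<close> puts the point on the
      hyperplane with index \<open>k\<close>. It tends to 0 because \<open>?w\<close> lies on the
      limit hyperplane.\<close>
    define w where "w k = ?w - (A k \<cdot>\<^sub>C (?w - P k) / (A k \<cdot>\<^sub>C ?n)) *s ?n" for k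
    have "w \<longlonglongrightarrow> ?w - (b \<cdot>\<^sub>C (?w - p) / (b \<cdot>\<^sub>C ?n)) *s ?n"
      unfolding w_def using n by (intro tendsto_intros A P) auto
    then have w: "w \<longlonglongrightarrow> ?w" unfolding bw by simp
    have evD: "\<forall>\<^sub>F k in sequentially. w k \<in> D"
      using topological_tendstoD[OF w D t] .
    have "(\<lambda>k. A k \<cdot>\<^sub>C ?n) \<longlonglongrightarrow> 1"
      using tendsto_bilinear_dot[OF A tendsto_const[of ?n]] n by simp
    then have "\<forall>\<^sub>F k in sequentially. A k \<cdot>\<^sub>C ?n \<noteq> 0"
      by (rule tendsto_imp_eventually_ne) simp
    with evD have "\<forall>\<^sub>F k in sequentially. \<rho> (w k) = P k"
    proof eventually_elim
      case (elim k)
      have "A k \<cdot>\<^sub>C (w k - P k) = 0"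
        using elim by (simp add: w_def bilinear_dot_diff_right bilinear_dot_scale_right)
      then show ?case using fib elim by blast
    qed
    moreover have "(\<lambda>k. \<rho> (w k)) \<longlonglongrightarrow> \<rho> ?w"
      using continuous_on_tendsto_compose[OF \<rho>(1) w t evD] .
    ultimately have "P \<longlonglongrightarrow> \<rho> ?w"
      using tendsto_cong by fastforce
    then have "p = \<rho> ?w" using P LIMSEQ_unique by blast
    then show False using \<rho>(2) t pD by auto
  qed
  \<comment> \<open>The kernel of \<open>b\<close> is a complex subspace: \<open>-v\<close> excludes
    a positive derivative, and \<open>\<i> *s v\<close> then supplies the imaginary part.\<close>
  have re: "Re (dz_gradient r p \<cdot>\<^sub>C v) = 0" if v: "b \<cdot>\<^sub>C v = 0" for v
  proof -
    have "b \<cdot>\<^sub>C ((-1) *s v) = 0" unfolding bilinear_dot_scale_right v by simp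
    from no_neg[OF this] no_neg[OF v] show ?thesis
      unfolding frechet_derivative_eq_dz_gradient[OF diff] bilinear_dot_scale_right by simp
  qed
  have "b \<cdot>\<^sub>C (\<i> *s v) = 0" unfolding bilinear_dot_scale_right v by simp
  from re[OF this] re[OF v] show ?thesis
    by (simp add: bilinear_dot_scale_right complex_eq_iff)
qed

text \<open>Constancy of \<rho> on the fiber makes \<open>L\<close> vanish along the hyperplane, and
  \<open>L\<close> fixes the transversal vector \<open>v\<close>. So \<open>L\<close> has rank one
  with image spanned by \<open>v\<close>; pairing with any \<open>b\<close> satisfying
  \<open>b \<cdot>\<^sub>C v = 1\<close> reads off the coefficient, which is the normalised equation
  of the hyperplane.\<close>

lemma fiber_hyperplane_normal:
  fixes D :: "(complex ^ 'n) set"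
  assumes D: "open D" "p \<in> D" and L: "(\<rho> has_derivative L) (at p)"
    and cl: "\<And>c x. L (c *s x) = c *s L x"
    and v: "L v = v" "b \<cdot>\<^sub>C v = 1"
    and H: "complex_affine_hyperplane H" "{z \<in> D. \<rho> z = p} = D \<inter> H" and p: "\<rho> p = p"
  defines "a \<equiv> \<chi> j. b \<cdot>\<^sub>C L (axis j 1)"
  shows "a \<cdot>\<^sub>C v = 1" and "H = {z. a \<cdot>\<^sub>C (z - p) = 0}"
proof -
  obtain \<alpha> c where Hc: "H = {z. \<alpha> \<cdot>\<^sub>C z = c}"
    using H(1) by (auto simp: complex_affine_hyperplane_def)
  have "p \<in> H" using H(2) D p by blast
  then have c: "c = \<alpha> \<cdot>\<^sub>C p" by (simp add: Hc)
  have lin: "linear L" using L has_derivative_linear by blast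
  \<comment> \<open>Near \<open>p\<close> the real line in direction \<open>w\<close> stays in
    \<open>D\<close> and in the hyperplane, where \<rho> is constant.\<close>
  have ker: "L w = 0" if w: "\<alpha> \<cdot>\<^sub>C w = 0" for w
  proof -
    let ?g = "\<lambda>t::real. p + t *\<^sub>R w"
    have "(?g has_derivative (\<lambda>t. t *\<^sub>R w)) (at 0)"
      by (auto intro!: derivative_eq_intros)
    then have der: "((\<lambda>t. \<rho> (?g t)) has_derivative (\<lambda>t. L (t *\<^sub>R w))) (at 0)"
      by (rule has_derivative_compose) (use L in simp)
    have op: "open (?g -` D)"
      by (intro open_vimage D(1) continuous_intros)
    have "((\<lambda>t. p) has_derivative (\<lambda>t. L (t *\<^sub>R w))) (at (0::real))"
    proof (rule has_derivative_transform_within_open[OF der op])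
      show "\<rho> (?g t) = p" if "t \<in> ?g -` D" for t
      proof -
        have "?g t \<in> D \<inter> H"
          using that by (simp add: Hc c bilinear_dot_add_right scaleR_eq_vector_smult
              bilinear_dot_scale_right w)
        then show ?thesis using H(2) by blast
      qed
    qed (use D in simp)
    from has_derivative_unique[OF this has_derivative_const]
    have "L (1 *\<^sub>R w) = 0" by metis
    then show ?thesis by simp
  qed
  have \<alpha>v: "\<alpha> \<cdot>\<^sub>C v \<noteq> 0"
  proof
    assume "\<alpha> \<cdot>\<^sub>C v = 0"
    then have "v = 0" using ker v(1) by simp
    then show False using v(2) by (simp add: bilinear_dot_def)
  qed
  have Lx: "b \<cdot>\<^sub>C L x = \<alpha> \<cdot>\<^sub>C x / (\<alpha> \<cdot>\<^sub>C v)" for x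
  proof -
    have "L (x - (\<alpha> \<cdot>\<^sub>C x / (\<alpha> \<cdot>\<^sub>C v)) *s v) = 0"
      by (rule ker) (simp add: bilinear_dot_diff_right bilinear_dot_scale_right \<alpha>v)
    then have "L x = (\<alpha> \<cdot>\<^sub>C x / (\<alpha> \<cdot>\<^sub>C v)) *s v"
      by (simp add: linear_diff[OF lin] cl v(1))
    then show ?thesis by (simp add: bilinear_dot_scale_right v(2))
  qed
  have "a = (1 / (\<alpha> \<cdot>\<^sub>C v)) *s \<alpha>"
    by (simp add: vec_eq_iff a_def Lx bilinear_dot_axis)
  then have a: "a \<cdot>\<^sub>C x = \<alpha> \<cdot>\<^sub>C x / (\<alpha> \<cdot>\<^sub>C v)" for x
    by (simp add: bilinear_dot_scale_left)
  show "a \<cdot>\<^sub>C v = 1" by (simp add: a \<alpha>v)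
  show "H = {z. a \<cdot>\<^sub>C (z - p) = 0}"
    by (auto simp: Hc c a \<alpha>v bilinear_dot_diff_right)
qed

section \<open>The maximum principle with sequential boundary values\<close>

text \<open>Extended by 0 to the circle, \<open>f\<close> becomes continuous on the closed disc.
  Limits along subsequences suffice, since a failure of continuity yields a sequence of values
  bounded away from 0.\<close>

lemma holomorphic_eq_0_if_boundary_limits_0:
  assumes hol: "f holomorphic_on ball 0 1"
    and lim: "\<And>\<omega> \<zeta>. \<omega> \<in> sphere 0 1 \<Longrightarrow> (\<And>k. \<zeta> k \<in> ball 0 1) \<Longrightarrow> \<zeta> \<longlonglongrightarrow> \<omega> \<Longrightarrow>
      \<exists>s::nat \<Rightarrow> nat. (\<lambda>k. f (\<zeta> (s k))) \<longlonglongrightarrow> 0"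
    and z: "z \<in> ball 0 1"
  shows "f z = 0"
proof -
  define F where "F x = (if x \<in> ball 0 1 then f x else 0)" for x
  have holF: "F holomorphic_on ball 0 1"
    using hol by (rule holomorphic_transform) (simp add: F_def)
  have "continuous (at \<omega> within cball 0 1) F" if \<omega>: "\<omega> \<in> cball 0 1" for \<omega>
  proof (cases "\<omega> \<in> ball 0 1")
    case True
    then show ?thesis
      using holF by (meson continuous_at_imp_continuous_within continuous_on_eq_continuous_at
          holomorphic_on_imp_continuous_on open_ball)
  next
    case False
    with \<omega> have \<omega>: "\<omega> \<in> sphere 0 1" by auto
    show ?thesis
    proof (rule ccontr)
      assume "\<not> ?thesis"
      then obtain e where e: "0 < e"
        and bad: "\<And>d. 0 < d \<Longrightarrow> \<exists>x\<in>cball 0 1. dist x \<omega> < d \<and> e \<le> dist (F x) (F \<omega>)"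
        unfolding continuous_within_eps_delta by (meson not_le)
      have "\<exists>x\<in>cball 0 1. dist x \<omega> < inverse (real (Suc k)) \<and> e \<le> dist (F x) (F \<omega>)" for k
        by (intro bad) simp
      then obtain \<zeta> where \<zeta>: "\<And>k. dist (\<zeta> k) \<omega> < inverse (real (Suc k))"
        "\<And>k. e \<le> dist (F (\<zeta> k)) (F \<omega>)" by metis
      have F\<omega>: "F \<omega> = 0" using False by (simp add: F_def)
      \<comment> \<open>Off the open disc \<open>F\<close> is 0, so points with values away from 0
        lie inside it.\<close>
      have mem: "\<zeta> k \<in> ball 0 1" for k
        using \<zeta>(2)[of k] e unfolding F\<omega> by (rule_tac ccontr) (simp add: F_def)
      have "\<zeta> \<longlonglongrightarrow> \<omega>"
        by (rule metric_tendsto_imp_tendsto[OF LIMSEQ_inverse_real_of_nat])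
          (use \<zeta>(1) in \<open>auto intro!: always_eventually less_imp_le\<close>)
      from lim[OF \<omega> mem this] obtain s where s: "(\<lambda>k. f (\<zeta> (s k))) \<longlonglongrightarrow> 0" by blast
      have "e \<le> norm (f (\<zeta> (s k)))" for k
        using \<zeta>(2)[of "s k"] mem[of "s k"] unfolding F\<omega> by (simp add: F_def)
      then have "e \<le> 0"
        using tendsto_lowerbound[OF tendsto_norm[OF s], of e] by simp
      then show False using e by simp
    qed
  qed
  then have cont: "continuous_on (cball 0 1) F"
    by (simp add: continuous_on_eq_continuous_within)
  have "norm (F z) \<le> 0"
    by (rule maximum_modulus_frontier[of F "ball 0 1"])
      (use holF cont z in \<open>auto simp: F_def\<close>)
  then show ?thesis using z by (simp add: F_def)
qed

section \<open>Holomorphy of the normals and their limits at the circle\<close>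

lemma norm_bilinear_dot_le: "cmod (a \<cdot>\<^sub>C b) \<le> real CARD('n) * (norm a * norm b)"
  for a b :: "complex ^ 'n"
proof -
  have "cmod (a \<cdot>\<^sub>C b) \<le> (\<Sum>j\<in>(UNIV :: 'n set). norm a * norm b)"
    unfolding bilinear_dot_def
    by (intro sum_norm_le) (auto simp: norm_mult intro!: mult_mono Finite_Cartesian_Product.norm_nth_le)
  then show ?thesis by simp
qed

lemma holomorphic_disc_continuous_on:
  assumes "holomorphic_disc f"
  shows "continuous_on (ball 0 1) f"
  using holomorphic_disc_has_derivative[OF assms] has_derivative_continuous
  by (metis continuous_at_imp_continuous_on)

text \<open>Uniqueness of the derivative identifies the complex linear map of the definition with
  \<open>frechet_derivative\<close>.\<close>

lemma holomorphic_map_on_frechet: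
  assumes "holomorphic_map_on f S" "z \<in> S"
  shows "(f has_derivative frechet_derivative f (at z)) (at z)"
    and "frechet_derivative f (at z) (c *s v) = c *s frechet_derivative f (at z) v"
proof -
  obtain L where L: "(f has_derivative L) (at z)" "\<And>c v. L (c *s v) = c *s L v"
    using assms by (auto simp: holomorphic_map_on_def)
  have "frechet_derivative f (at z) = L" using frechet_derivative_at[OF L(1)] by simp
  then show "(f has_derivative frechet_derivative f (at z)) (at z)"
    and "frechet_derivative f (at z) (c *s v) = c *s frechet_derivative f (at z) v"
    using L by simp_all
qed

text \<open>Complex linearity of both differentials turns the real chain rule into a complex
  derivative.\<close>

lemma holomorphic_map_on_curve_component:
  assumes f: "holomorphic_map_on f S" and g: "(g has_derivative (\<lambda>h. h *s v)) (at x)" "g x \<in> S"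
  shows "((\<lambda>y. f (g y) $ j) has_field_derivative frechet_derivative f (at (g x)) v $ j) (at x)"
proof -
  have "((\<lambda>y. f (g y)) has_derivative (\<lambda>h. frechet_derivative f (at (g x)) (h *s v))) (at x)"
    by (rule has_derivative_compose[OF g(1) holomorphic_map_on_frechet(1)[OF f g(2)]])
  then have "((\<lambda>y. f (g y)) has_derivative (\<lambda>h. h *s frechet_derivative f (at (g x)) v)) (at x)"
    by (simp only: holomorphic_map_on_frechet(2)[OF f g(2)])
  from bounded_linear.has_derivative[OF bounded_linear_vec_nth this, of j]
  show ?thesis
    by (simp add: has_field_derivative_def mult.commute[of _ "frechet_derivative _ _ _ $ _"])
qed

text \<open>The expression is the derivative at \<open>t = 0\<close> of \<open>\<psi> \<zeta>
  \<cdot>\<^sub>C \<rho> (\<phi> \<zeta> + t *s e)\<close>, which is holomorphic in each variable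
  and, as \<rho> is bounded, locally bounded. Hence \<open>holomorphic_on_partial_deriv\<close>
  applies, with no prior continuity of the differential of \<rho>.\<close>

lemma holomorphic_dot_frechet_derivative:
  fixes \<rho> :: "complex ^ 'n \<Rightarrow> complex ^ 'm"
  assumes D: "open D" and \<rho>: "holomorphic_map_on \<rho> D" "bounded (\<rho> ` D)"
    and \<phi>: "holomorphic_disc \<phi>" "\<phi> ` ball 0 1 \<subseteq> D" and \<psi>: "holomorphic_disc \<psi>"
  shows "(\<lambda>\<zeta>. \<psi> \<zeta> \<cdot>\<^sub>C frechet_derivative \<rho> (at (\<phi> \<zeta>)) e) holomorphic_on ball 0 1"
proof -
  obtain C where C: "\<And>z. z \<in> D \<Longrightarrow> norm (\<rho> z) \<le> C"
    using \<rho>(2) by (auto simp: bounded_iff)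
  have local: "\<exists>S. open S \<and> x \<in> S \<and>
      (\<lambda>\<zeta>. \<psi> \<zeta> \<cdot>\<^sub>C frechet_derivative \<rho> (at (\<phi> \<zeta>)) e) holomorphic_on S"
    if x: "x \<in> ball 0 1" for x
  proof -
    have "\<phi> x \<in> D" using \<phi>(2) x by auto
    then obtain R0 where R0: "0 < R0" "ball (\<phi> x) R0 \<subseteq> D"
      using D open_contains_ball by blast
    \<comment> \<open>Half of \<open>R0\<close> is reserved for the displacement of
      \<open>\<phi> y\<close>, half for \<open>t *s e\<close>; the summand 1 covers
      \<open>e = 0\<close>.\<close>
    define R where "R = R0 / 2 / (norm e + 1)"
    have R: "0 < R" using R0 by (simp add: R_def add_nonneg_pos)
    have Re: "R * norm e \<le> R0 / 2"
    proof -
      have "R * norm e \<le> R * (norm e + 1)" using R by simp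
      moreover have "norm e + 1 \<noteq> 0" using norm_ge_zero[of e] by linarith
      then have "R * (norm e + 1) = R0 / 2" by (metis R_def nonzero_divide_eq_eq)
      ultimately show ?thesis by simp
    qed
    have "(\<phi> \<longlongrightarrow> \<phi> x) (nhds x)" "(\<psi> \<longlongrightarrow> \<psi> x) (nhds x)"
      unfolding tendsto_at_iff_tendsto_nhds[symmetric] isCont_def[symmetric]
      using holomorphic_disc_continuous_on[OF \<phi>(1)] holomorphic_disc_continuous_on[OF \<psi>] x
      by (simp_all add: continuous_on_eq_continuous_at)
    then have "\<forall>\<^sub>F y in nhds x. dist (\<phi> y) (\<phi> x) < R0 / 2" "\<forall>\<^sub>F y in nhds x. dist (\<psi> y) (\<psi> x) < 1"
      using tendstoD[of \<phi> "\<phi> x" "nhds x" "R0 / 2"] tendstoD[of \<psi> "\<psi> x" "nhds x" 1] R0(1)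
      by simp_all
    moreover have "\<forall>\<^sub>F y in nhds x. y \<in> ball 0 1"
      using x by (intro eventually_nhds_in_open) auto
    ultimately have "\<forall>\<^sub>F y in nhds x. dist (\<phi> y) (\<phi> x) < R0 / 2 \<and> dist (\<psi> y) (\<psi> x) < 1 \<and> y \<in> ball 0 1"
      by eventually_elim auto
    then obtain S where S: "open S" "x \<in> S" and
      near: "\<And>y. y \<in> S \<Longrightarrow> dist (\<phi> y) (\<phi> x) < R0 / 2 \<and> dist (\<psi> y) (\<psi> x) < 1 \<and> y \<in> ball 0 1"
      unfolding eventually_nhds by blast
    define f where "f y t = \<psi> y \<cdot>\<^sub>C \<rho> (\<phi> y + t *s e)" for y t
    have inD: "\<phi> y + t *s e \<in> D" if "y \<in> S" "t \<in> ball 0 R" for y t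
    proof -
      have "norm (t *s e) \<le> R * norm e"
        using that by (simp add: norm_vector_smult mult_right_mono)
      then have "dist (\<phi> x) (\<phi> y + t *s e) < R0"
        using near[OF that(1)] Re norm_triangle_ineq[of "\<phi> y - \<phi> x" "t *s e"]
        by (simp add: dist_norm norm_minus_commute algebra_simps)
      then show ?thesis using R0(2) by auto
    qed
    have dert: "(f y has_field_derivative \<psi> y \<cdot>\<^sub>C frechet_derivative \<rho> (at (\<phi> y + t *s e)) e) (at t)"
      if "y \<in> S" "t \<in> ball 0 R" for y t
      unfolding f_def bilinear_dot_def
    proof (intro DERIV_sum DERIV_cmult)
      fix j
      have "((\<lambda>t. \<phi> y + t *s e) has_derivative (\<lambda>h. h *s e)) (at t)"
        by (rule has_derivative_vec_componentwise) (auto intro!: derivative_eq_intros)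
      then show "((\<lambda>t. \<rho> (\<phi> y + t *s e) $ j) has_field_derivative
          frechet_derivative \<rho> (at (\<phi> y + t *s e)) e $ j) (at t)"
        by (rule holomorphic_map_on_curve_component[OF \<rho>(1)]) (use inD that in auto)
    qed
    have "(\<lambda>y. deriv (f y) 0) holomorphic_on S"
    proof (rule holomorphic_on_partial_deriv[OF S(1) R])
      show "(\<lambda>y. f y t) holomorphic_on S" if t: "t \<in> ball 0 R" for t
        unfolding f_def bilinear_dot_def
      proof (intro holomorphic_intros)
        fix j
        show "(\<lambda>y. \<psi> y $ j) holomorphic_on S"
          using \<psi> near by (auto simp: holomorphic_disc_def intro: holomorphic_on_subset)
        show "(\<lambda>y. \<rho> (\<phi> y + t *s e) $ j) holomorphic_on S"
          unfolding holomorphic_on_open[OF S(1)]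
        proof
          fix y assume y: "y \<in> S"
          have "((\<lambda>y. \<phi> y + t *s e) has_derivative (\<lambda>h. h *s disc_deriv \<phi> y)) (at y)"
            using has_derivative_add_const[OF holomorphic_disc_has_derivative[OF \<phi>(1)]] near[OF y]
            by blast
          from holomorphic_map_on_curve_component[OF \<rho>(1) this inD[OF y t]]
          show "\<exists>f'. ((\<lambda>y. \<rho> (\<phi> y + t *s e) $ j) has_field_derivative f') (at y)" by blast
        qed
      qed
      show "f y holomorphic_on ball 0 R" if "y \<in> S" for y
        using dert[OF that] holomorphic_on_open[OF open_ball] by blast
      show "cmod (f y t) \<le> real CARD('m) * ((norm (\<psi> x) + 1) * C)"
        if "y \<in> S" "t \<in> ball 0 R" for y t
      proof -
        have "norm (\<psi> y) \<le> norm (\<psi> x) + 1"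
          using near[OF that(1)] norm_triangle_sub[of "\<psi> y" "\<psi> x"] by (simp add: dist_norm)
        then have "norm (\<psi> y) * norm (\<rho> (\<phi> y + t *s e)) \<le> (norm (\<psi> x) + 1) * C"
          using C[OF inD[OF that]] by (intro mult_mono) auto
        then show ?thesis
          unfolding f_def by (intro order_trans[OF norm_bilinear_dot_le] mult_left_mono) auto
      qed
    qed
    moreover have "deriv (f y) 0 = \<psi> y \<cdot>\<^sub>C frechet_derivative \<rho> (at (\<phi> y)) e" if "y \<in> S" for y
      using DERIV_imp_deriv[OF dert[OF that, of 0]] R by simp
    ultimately have "(\<lambda>\<zeta>. \<psi> \<zeta> \<cdot>\<^sub>C frechet_derivative \<rho> (at (\<phi> \<zeta>)) e) holomorphic_on S"
      by (rule holomorphic_transform)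
    then show ?thesis using S by blast
  qed
  show ?thesis
    unfolding holomorphic_on_def
  proof
    fix x :: complex assume "x \<in> ball 0 1"
    from local[OF this] obtain S where S: "open S" "x \<in> S"
      "(\<lambda>\<zeta>. \<psi> \<zeta> \<cdot>\<^sub>C frechet_derivative \<rho> (at (\<phi> \<zeta>)) e) holomorphic_on S" by blast
    then show "(\<lambda>\<zeta>. \<psi> \<zeta> \<cdot>\<^sub>C frechet_derivative \<rho> (at (\<phi> \<zeta>)) e) field_differentiable at x within ball 0 1"
      by (meson field_differentiable_at_within holomorphic_on_imp_differentiable_at)
  qed
qed

text \<open>The normals \<open>a \<zeta>\<close> are only known to converge as directions; the normalisation against
  \<open>\<phi>'\<close>, which is shared with \<open>\<phi>t\<close> and survives at the boundary, controls their lengths.\<close>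

lemma fiber_normals_tendsto_dual_map:
  fixes D :: "(complex ^ 'n) set"
  assumes D: "open D" and geo: "complex_geodesic D \<phi>"
    and hol_t: "holomorphic_disc \<phi>t"
    and ext: "smooth_extension \<phi> \<Phi>" "smooth_extension \<phi>t \<Phi>t"
    and r: "defining_function_on D U r" "\<Phi> ` sphere 0 1 \<subseteq> U"
    and \<Phi>t: "\<And>\<zeta>. \<zeta> \<in> sphere 0 1 \<Longrightarrow> \<Phi>t \<zeta> = m \<zeta> *s dz_gradient r (\<Phi> \<zeta>)"
    and norm1: "\<And>\<zeta>. \<zeta> \<in> ball 0 1 \<Longrightarrow> \<phi>t \<zeta> \<cdot>\<^sub>C disc_deriv \<phi> \<zeta> = 1"
    and \<rho>: "continuous_on D \<rho>" "\<rho> ` D \<subseteq> \<phi> ` ball 0 1"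
    and \<rho>\<phi>: "\<And>\<zeta>. \<zeta> \<in> ball 0 1 \<Longrightarrow> \<rho> (\<phi> \<zeta>) = \<phi> \<zeta>"
    and a: "\<And>\<zeta>. \<zeta> \<in> ball 0 1 \<Longrightarrow> a \<zeta> \<cdot>\<^sub>C disc_deriv \<phi> \<zeta> = 1"
    and fib: "\<And>\<zeta> z. \<zeta> \<in> ball 0 1 \<Longrightarrow> z \<in> D \<Longrightarrow> a \<zeta> \<cdot>\<^sub>C (z - \<phi> \<zeta>) = 0 \<Longrightarrow> \<rho> z = \<phi> \<zeta>"
    and \<omega>: "\<omega> \<in> sphere 0 1" and \<zeta>: "\<And>k. \<zeta> k \<in> ball 0 1" "\<zeta> \<longlonglongrightarrow> \<omega>"
  shows "\<exists>s::nat \<Rightarrow> nat. strict_mono s \<and> (\<lambda>k. a (\<zeta> (s k))) \<longlonglongrightarrow> \<Phi>t \<omega>"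
proof -
  have hol: "holomorphic_disc \<phi>" and im: "\<phi> ` ball 0 1 \<subseteq> D"
    using geo by (auto simp: complex_geodesic_def)
  let ?d = "frechet_derivative \<Phi> (at \<omega>) 1"
  have \<omega>c: "\<omega> \<in> cball 0 1" using \<omega> by auto
  have \<zeta>c: "\<forall>\<^sub>F k in sequentially. \<zeta> k \<in> cball 0 1"
    using \<zeta>(1) by (intro always_eventually) (meson ball_subset_cball subsetD)
  note ext\<phi> = holomorphic_disc_smooth_extension[OF hol ext(1)]
  note ext\<phi>t = holomorphic_disc_smooth_extension[OF hol_t ext(2)]
  have lim\<phi>: "(\<lambda>k. \<phi> (\<zeta> k)) \<longlonglongrightarrow> \<Phi> \<omega>"
    using continuous_on_tendsto_compose[OF ext\<phi>(1) \<zeta>(2) \<omega>c \<zeta>c] ext(1) \<zeta>(1)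
    by (simp add: smooth_extension_def)
  have lim\<phi>t: "(\<lambda>k. \<phi>t (\<zeta> k)) \<longlonglongrightarrow> \<Phi>t \<omega>"
    using continuous_on_tendsto_compose[OF ext\<phi>t(1) \<zeta>(2) \<omega>c \<zeta>c] ext(2) \<zeta>(1)
    by (simp add: smooth_extension_def)
  have limd: "(\<lambda>k. disc_deriv \<phi> (\<zeta> k)) \<longlonglongrightarrow> ?d"
    using continuous_on_tendsto_compose[OF ext\<phi>(2) \<zeta>(2) \<omega>c \<zeta>c] ext\<phi>(3)[OF \<zeta>(1)]
    by simp
  have td: "\<Phi>t \<omega> \<cdot>\<^sub>C ?d = 1"
    by (rule LIMSEQ_unique[OF tendsto_bilinear_dot[OF lim\<phi>t limd]]) (simp add: norm1[OF \<zeta>(1)])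
  \<comment> \<open>Otherwise \<rho> would fix this point by continuity, placing it in the image of
    \<phi>, which a geodesic cannot approach from the circle.\<close>
  have "\<Phi> \<omega> \<notin> D"
  proof
    assume "\<Phi> \<omega> \<in> D"
    moreover have "\<forall>\<^sub>F k in sequentially. \<phi> (\<zeta> k) \<in> D"
      using im \<zeta>(1) by (intro always_eventually) blast
    ultimately have "(\<lambda>k. \<rho> (\<phi> (\<zeta> k))) \<longlonglongrightarrow> \<rho> (\<Phi> \<omega>)"
      using continuous_on_tendsto_compose[OF \<rho>(1) lim\<phi>] by blast
    then have "\<rho> (\<Phi> \<omega>) = \<Phi> \<omega>"
      using lim\<phi> \<rho>\<phi>[OF \<zeta>(1)] LIMSEQ_unique by simp
    then obtain \<eta> where "\<eta> \<in> ball 0 1" "\<Phi> \<omega> = \<phi> \<eta>"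
      using \<rho>(2) \<open>\<Phi> \<omega> \<in> D\<close> by force
    then show False
      using complex_geodesic_limit_not_in_image[OF D geo \<omega> \<zeta>] lim\<phi> by simp
  qed
  moreover have "\<Phi> \<omega> \<in> closure D"
    using im \<zeta>(1) lim\<phi> by (force simp: closure_sequential)
  ultimately have front: "\<Phi> \<omega> \<in> frontier D"
    using D by (simp add: frontier_def interior_open)
  have a0: "a (\<zeta> k) \<noteq> 0" for k
    using a[OF \<zeta>(1)[of k]] by (auto simp: bilinear_dot_def)
  \<comment> \<open>Unit vectors have a convergent subsequence; dividing by the pairing with the
    derivative of \<phi> later recovers \<open>a\<close> from \<open>A\<close>.\<close>
  define A where "A k = complex_of_real (1 / norm (a (\<zeta> k))) *s a (\<zeta> k)" for k
  have "norm (A k) = 1" for k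
    using a0[of k] unfolding A_def norm_vector_smult by (simp add: norm_divide)
  then have "\<forall>k. A k \<in> sphere 0 1" by simp
  then obtain b s where b: "b \<in> sphere 0 1" and s: "strict_mono (s :: nat \<Rightarrow> nat)"
    and limA: "(A \<circ> s) \<longlonglongrightarrow> b"
    using compact_sphere[of "0 :: complex ^ 'n" 1] unfolding compact_def by blast
  have sub: "(\<lambda>k. f (s k)) \<longlonglongrightarrow> l" if "f \<longlonglongrightarrow> l" for f :: "nat \<Rightarrow> complex ^ 'n" and l
    using LIMSEQ_subseq_LIMSEQ[OF that s] by (simp add: o_def)
  have "dz_gradient r (\<Phi> \<omega>) \<cdot>\<^sub>C v = 0" if "b \<cdot>\<^sub>C v = 0" for v
  proof (rule limit_of_fiber_normals[OF D \<rho>(1) _ r(1) _ front sub[OF lim\<phi>] limA _ _ that])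
    show "\<rho> ` D \<subseteq> D" using \<rho>(2) im by blast
    show "\<Phi> \<omega> \<in> U" using r(2) \<omega> by blast
    show "norm b = 1" using b by simp
    show "\<rho> z = \<phi> (\<zeta> (s k))" if "z \<in> D" "(A \<circ> s) k \<cdot>\<^sub>C (z - \<phi> (\<zeta> (s k))) = 0" for k z
      using that a0[of "s k"] by (intro fib \<zeta>) (auto simp: A_def bilinear_dot_scale_left)
  qed
  then obtain c where "dz_gradient r (\<Phi> \<omega>) = c *s b"
    using bilinear_dot_proportional[of b] b by auto
  then have \<Phi>tb: "\<Phi>t \<omega> = (m \<omega> * c) *s b"
    using \<Phi>t[OF \<omega>] by (simp add: vector_smult_assoc)
  \<comment> \<open>The normalisation of the dual map, carried to \<omega>, makes the limit
    direction \<open>b\<close> pair nontrivially with the boundary derivative of \<phi>, so the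
    lengths of the normals converge too.\<close>
  then have mb: "m \<omega> * c * (b \<cdot>\<^sub>C ?d) = 1"
    using td by (simp add: bilinear_dot_scale_left)
  then have bd: "b \<cdot>\<^sub>C ?d \<noteq> 0" by auto
  have "a (\<zeta> k) = (1 / (A k \<cdot>\<^sub>C disc_deriv \<phi> (\<zeta> k))) *s A k" for k
    using a0[of k] a[OF \<zeta>(1)[of k]]
    by (simp add: A_def bilinear_dot_scale_left vector_smult_assoc)
  moreover have "(\<lambda>k. (1 / ((A \<circ> s) k \<cdot>\<^sub>C disc_deriv \<phi> (\<zeta> (s k)))) *s (A \<circ> s) k) \<longlonglongrightarrow>
      (1 / (b \<cdot>\<^sub>C ?d)) *s b"
    by (intro tendsto_intros limA sub[OF limd] bd)
  moreover have "(1 / (b \<cdot>\<^sub>C ?d)) *s b = \<Phi>t \<omega>"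
    using mb bd by (simp add: \<Phi>tb field_simps)
  ultimately show ?thesis using s by auto
qed

section \<open>Identification of the fibers with those of the Lempert projection\<close>

theorem proposition3p3:
  fixes D :: "(complex ^ 'n) set"
    and \<phi> \<phi>t :: "complex \<Rightarrow> complex ^ 'n"
    and \<rho> :: "complex ^ 'n \<Rightarrow> complex ^ 'n"
  assumes "open D" and "connected D" and "D \<noteq> {}" and "bounded D"
    and "strongly_convex_smooth D"
    and "complex_geodesic D \<phi>"
    and "dual_map D \<phi> \<phi>t"
    and "holomorphic_retraction_onto D (\<phi> ` ball 0 1) \<rho>"
    and "\<forall>p \<in> \<phi> ` ball 0 1. \<exists>H. complex_affine_hyperplane H \<and> {z \<in> D. \<rho> z = p} = D \<inter> H"
  shows "\<forall>z\<in>D. \<rho> z = lempert_projection \<phi> \<phi>t z"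
proof -
  have hol: "holomorphic_disc \<phi>" and im: "\<phi> ` ball 0 1 \<subseteq> D"
    using assms(6) by (auto simp: complex_geodesic_def)
  have \<rho>: "holomorphic_map_on \<rho> D" "\<rho> ` D \<subseteq> \<phi> ` ball 0 1"
    and \<rho>\<phi>: "\<And>\<zeta>. \<zeta> \<in> ball 0 1 \<Longrightarrow> \<rho> (\<phi> \<zeta>) = \<phi> \<zeta>"
    using assms(8) by (auto simp: holomorphic_retraction_onto_def)
  have cont: "continuous_on D \<rho>"
    using holomorphic_map_on_frechet(1)[OF \<rho>(1)] has_derivative_continuous
      continuous_at_imp_continuous_on by blast
  have hol_t: "holomorphic_disc \<phi>t"
    and norm1: "\<And>\<zeta>. \<zeta> \<in> ball 0 1 \<Longrightarrow> \<phi>t \<zeta> \<cdot>\<^sub>C disc_deriv \<phi> \<zeta> = 1"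
    using assms(7) by (auto simp: dual_map_def)
  from assms(7)[unfolded dual_map_def, THEN conjunct2, THEN conjunct1]
  obtain \<Phi> \<Phi>t U r \<mu> where dual: "smooth_extension \<phi> \<Phi> \<and> smooth_extension \<phi>t \<Phi>t \<and>
      defining_function_on D U r \<and> \<Phi> ` sphere 0 1 \<subseteq> U \<and>
      (\<forall>\<zeta>\<in>sphere 0 1. (\<mu> \<zeta> :: real) > 0 \<and>
         \<Phi>t \<zeta> = (\<zeta> * of_real (\<mu> \<zeta>)) *s dz_gradient r (\<Phi> \<zeta>))"
    by (elim exE)
  have ext: "smooth_extension \<phi> \<Phi>" "smooth_extension \<phi>t \<Phi>t"
    and r: "defining_function_on D U r" "\<Phi> ` sphere 0 1 \<subseteq> U"
    and \<Phi>t: "\<And>\<zeta>. \<zeta> \<in> sphere 0 1 \<Longrightarrow> \<Phi>t \<zeta> = (\<zeta> * of_real (\<mu> \<zeta>)) *s dz_gradient r (\<Phi> \<zeta>)"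
    using dual by simp_all
  define L where "L \<zeta> = frechet_derivative \<rho> (at (\<phi> \<zeta>))" for \<zeta>
  \<comment> \<open>The dual map pairs to 1 with the derivative of \<phi>, which spans the image of
    \<open>L \<zeta>\<close>, and it varies holomorphically with \<zeta>.\<close>
  define a where "a \<zeta> = (\<chi> j. \<phi>t \<zeta> \<cdot>\<^sub>C L \<zeta> (axis j 1))" for \<zeta>
  have normal: "a \<zeta> \<cdot>\<^sub>C disc_deriv \<phi> \<zeta> = 1 \<and> {z \<in> D. \<rho> z = \<phi> \<zeta>} = {z \<in> D. a \<zeta> \<cdot>\<^sub>C (z - \<phi> \<zeta>) = 0}"
    if \<zeta>: "\<zeta> \<in> ball 0 1" for \<zeta>
  proof -
    have D: "\<phi> \<zeta> \<in> D" using im \<zeta> by blast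
    note L = holomorphic_map_on_frechet[OF \<rho>(1) D, folded L_def]
    obtain H where H: "complex_affine_hyperplane H" "{z \<in> D. \<rho> z = \<phi> \<zeta>} = D \<inter> H"
      using assms(9) \<zeta> by blast
    have der: "(\<phi> has_derivative (\<lambda>h. h *s disc_deriv \<phi> \<zeta>)) (at \<zeta>)"
      by (rule holomorphic_disc_has_derivative[OF hol \<zeta>])
    \<comment> \<open>Differentiating the identity
      \<open>\<rho> (\<phi> \<zeta>) = \<phi> \<zeta>\<close> shows that \<open>L \<zeta>\<close>
      fixes the derivative of \<phi>.\<close>
    from has_derivative_transform_within_open[OF has_derivative_compose[OF this L(1)] open_ball \<zeta> \<rho>\<phi>]
    have "(\<phi> has_derivative (\<lambda>h. L \<zeta> (h *s disc_deriv \<phi> \<zeta>))) (at \<zeta>)" by blast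
    from has_derivative_unique[OF this der]
    have "L \<zeta> (1 *s disc_deriv \<phi> \<zeta>) = 1 *s disc_deriv \<phi> \<zeta>" by metis
    then have Ld: "L \<zeta> (disc_deriv \<phi> \<zeta>) = disc_deriv \<phi> \<zeta>" by simp
    note fiber_hyperplane_normal[OF assms(1) D L(1) L(2) Ld norm1[OF \<zeta>] H \<rho>\<phi>[OF \<zeta>], folded a_def]
    then show ?thesis using H(2) by auto
  qed
  have fib: "\<rho> z = \<phi> \<zeta> \<longleftrightarrow> a \<zeta> \<cdot>\<^sub>C (z - \<phi> \<zeta>) = 0" if "\<zeta> \<in> ball 0 1" "z \<in> D" for \<zeta> z
    using normal[OF that(1)] that(2) by blast
  have a_eq: "a \<zeta> = \<phi>t \<zeta>" if \<zeta>: "\<zeta> \<in> ball 0 1" for \<zeta>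
    unfolding vec_eq_iff
  proof
    fix j
    have "a \<zeta> $ j - \<phi>t \<zeta> $ j = 0"
    proof (rule holomorphic_eq_0_if_boundary_limits_0[OF _ _ \<zeta>])
      have "bounded (\<rho> ` D)"
        using \<rho>(2) im assms(4) by (meson bounded_subset)
      from holomorphic_dot_frechet_derivative[OF assms(1) \<rho>(1) this hol im hol_t]
      show "(\<lambda>\<zeta>. a \<zeta> $ j - \<phi>t \<zeta> $ j) holomorphic_on ball 0 1"
        using hol_t by (auto simp: a_def L_def holomorphic_disc_def intro!: holomorphic_intros)
    next
      fix \<omega> :: complex and \<xi> :: "nat \<Rightarrow> complex"
      assume \<omega>: "\<omega> \<in> sphere 0 1" and \<xi>: "\<And>k::nat. \<xi> k \<in> ball 0 1" "\<xi> \<longlonglongrightarrow> \<omega>"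
      obtain s where s: "strict_mono (s :: nat \<Rightarrow> nat)" "(\<lambda>k. a (\<xi> (s k))) \<longlonglongrightarrow> \<Phi>t \<omega>"
        using fiber_normals_tendsto_dual_map[OF assms(1,6) hol_t ext r \<Phi>t norm1 cont \<rho>(2) \<rho>\<phi>,
            where a = a and \<omega> = \<omega> and \<zeta> = \<xi>] normal fib \<omega> \<xi> by blast
      have "(\<lambda>k. \<Phi>t (\<xi> (s k))) \<longlonglongrightarrow> \<Phi>t \<omega>"
        by (rule continuous_on_tendsto_compose[OF holomorphic_disc_smooth_extension(1)[OF hol_t ext(2)]])
          (use LIMSEQ_subseq_LIMSEQ[OF \<xi>(2) s(1)] \<xi>(1) \<omega> in \<open>auto simp: o_def less_imp_le\<close>)
      then have "(\<lambda>k. \<phi>t (\<xi> (s k))) \<longlonglongrightarrow> \<Phi>t \<omega>"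
        using ext(2) \<xi>(1) by (simp add: smooth_extension_def)
      from tendsto_diff[OF tendsto_vec_nth[OF s(2), of j] tendsto_vec_nth[OF this, of j]]
      show "\<exists>s::nat \<Rightarrow> nat. (\<lambda>k. a (\<xi> (s k)) $ j - \<phi>t (\<xi> (s k)) $ j) \<longlonglongrightarrow> 0"
        by auto
    qed
    then show "a \<zeta> $ j = \<phi>t \<zeta> $ j" by simp
  qed
  show ?thesis
  proof
    fix z assume z: "z \<in> D"
    then obtain \<zeta> where \<zeta>: "\<zeta> \<in> ball 0 1" "\<rho> z = \<phi> \<zeta>" using \<rho>(2) by blast
    have "lempert_left_inverse \<phi> \<phi>t z = \<zeta>"
      unfolding lempert_left_inverse_def
    \<comment> \<open>Any solution \<eta> puts \<open>z\<close> in the fiber over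
      \<open>\<phi> \<eta>\<close>, so \<open>\<phi> \<eta> = \<phi> \<zeta>\<close>, and
      injectivity of the geodesic gives uniqueness.\<close>
    proof (rule the_equality)
      show "\<zeta> \<in> ball 0 1 \<and> \<phi>t \<zeta> \<cdot>\<^sub>C (z - \<phi> \<zeta>) = 0"
        using \<zeta> fib z a_eq by metis
      show "\<eta> = \<zeta>" if "\<eta> \<in> ball 0 1 \<and> \<phi>t \<eta> \<cdot>\<^sub>C (z - \<phi> \<eta>) = 0" for \<eta>
        using that \<zeta> fib[of \<eta> z] z a_eq[of \<eta>] complex_geodesic_inj_on[OF assms(6)]
        by (auto dest: inj_onD)
    qed
    then show "\<rho> z = lempert_projection \<phi> \<phi>t z"
      using \<zeta> by (simp add: lempert_projection_def)
  qed
qed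

end
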